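(* Any quantum algorithm that solves the Maximal Suffix problem on strings of length $n$ requires $\Omega(\sqrt n)$ quantum queries, and any quantum algorithm that solves the Minimal Suffix problem on strings of length $n$ requires $\Omega(\sqrt n)$ quantum queries.
   Context: Strings are 1-indexed sequences over an integer alphabet $\Sigma=\{1,\dots,|\Sigma|\}$ with $|\Sigma|\le n^{O(1)}$. $\prec$ is the lexicographic order: $s\prec t$ if $s$ is a proper prefix of $t$, or at the first position where they differ $s$ has the smaller character. Maximal Suffix: given $s$, output the position $i\in[1..|s|]$ such that $s[i..|s|]\succ s[j..|s|]$ for all $j\in[1..|s|]\setminus\{i\}$. Minimal Suffix: given $s$, output the position $i\in[1..|s|]$ such that $s[i..|s|]\prec s[j..|s|]$ for all $j\in[1..|s|]\setminus\{i\}$. Quantum query model: the input string $s$ is accessed through a unitary oracle $O_s:|i,b\rangle\mapsto|i,b\oplus s[i]\rangle$ ($\oplus$ is XOR of binary encodings of characters), which can be queried in superposition; between queries the algorithm may apply arbitrary unitaries independent of the input; it must output the correct answer with probability at least $2/3$. Query complexity is the number of oracle calls. *)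

theory Defs
  imports Complex_Main "HOL-Library.Log_Nat" "Jordan_Normal_Form.Schur_Decomposition"
begin

section \<open>Strings and the two suffix problems\<close>

text \<open>
  Strings are lists of natural numbers over the alphabet \<open>{1..\<sigma>}\<close>. Positions are 1-indexed,
  so the character at position \<open>i\<close> is \<open>s ! (i - 1)\<close>.
\<close>

definition strings :: "nat \<Rightarrow> nat \<Rightarrow> nat list set" where
  "strings \<sigma> n = {s. length s = n \<and> set s \<subseteq> {1..\<sigma>}}"

definition lex_less :: "nat list \<Rightarrow> nat list \<Rightarrow> bool" where
  "lex_less s t \<longleftrightarrow> (s, t) \<in> lexord {(a, b). a < b}"

definition suffix_from :: "nat list \<Rightarrow> nat \<Rightarrow> nat list" where
  "suffix_from s i = drop (i - 1) s"

definition is_maximal_suffix :: "nat list \<Rightarrow> nat \<Rightarrow> bool" where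
  "is_maximal_suffix s i \<longleftrightarrow> i \<in> {1..length s} \<and>
     (\<forall>j \<in> {1..length s} - {i}. lex_less (suffix_from s j) (suffix_from s i))"

definition is_minimal_suffix :: "nat list \<Rightarrow> nat \<Rightarrow> bool" where
  "is_minimal_suffix s i \<longleftrightarrow> i \<in> {1..length s} \<and>
     (\<forall>j \<in> {1..length s} - {i}. lex_less (suffix_from s i) (suffix_from s j))"

section \<open>The quantum query model\<close>

text \<open>
  The computational basis consists of the kets \<open>|i, b, w\<rangle>\<close> with \<open>i \<in> {1..n}\<close>, \<open>b < 2 ^ m\<close> and
  \<open>w < W\<close>, where \<open>m = floorlog 2 \<sigma>\<close> is the length of the binary expansion of \<open>\<sigma>\<close>, and \<open>W\<close> is the
  dimension of the workspace. The ket \<open>|i, b, w\<rangle>\<close> is the unit vector with index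
  \<open>((i - 1) * 2 ^ m + b) * W + w\<close>; the functions below recover the three components from the index.
\<close>

definition char_bits :: "nat \<Rightarrow> nat" where
  "char_bits \<sigma> = floorlog 2 \<sigma>"

definition ket_index :: "nat \<Rightarrow> nat \<Rightarrow> nat \<Rightarrow> nat" where
  "ket_index m W k = k div W div 2 ^ m + 1"

definition ket_value :: "nat \<Rightarrow> nat \<Rightarrow> nat \<Rightarrow> nat" where
  "ket_value m W k = k div W mod 2 ^ m"

definition ket_work :: "nat \<Rightarrow> nat \<Rightarrow> nat" where
  "ket_work W k = k mod W"

definition state_dim :: "nat \<Rightarrow> nat \<Rightarrow> nat \<Rightarrow> nat" where
  "state_dim m W n = n * 2 ^ m * W"

text \<open>The oracle \<open>O\<^sub>s\<close>, tensored with the identity on the workspace.\<close>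

definition oracle_mat :: "nat \<Rightarrow> nat \<Rightarrow> nat list \<Rightarrow> complex mat" where
  "oracle_mat m W s = mat (state_dim m W (length s)) (state_dim m W (length s))
     (\<lambda>(r, c). if ket_index m W r = ket_index m W c
                \<and> ket_value m W r = xor (ket_value m W c) (s ! (ket_index m W c - 1))
                \<and> ket_work W r = ket_work W c
              then 1 else 0)"

lemma oracle_mat_ket:
  assumes i: "i \<in> {1..length s}" and b: "b < 2 ^ m" and w: "w < W" and c: "s ! (i - 1) < 2 ^ m"
  defines "D \<equiv> state_dim m W (length s)"
  shows "oracle_mat m W s *\<^sub>v unit_vec D (((i - 1) * 2 ^ m + b) * W + w) =
         unit_vec D (((i - 1) * 2 ^ m + xor b (s ! (i - 1))) * W + w)"
proof -
  have bound: "((i - 1) * 2 ^ m + x) * W + w < D" if x: "x < 2 ^ m" for x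
  proof -
    have "((i - 1) * 2 ^ m + x) + 1 \<le> (i - 1) * 2 ^ m + 2 ^ m" using x by simp
    also have "\<dots> = i * 2 ^ m" using i by (cases i) auto
    also have "\<dots> \<le> length s * 2 ^ m" using i by simp
    finally have "(((i - 1) * 2 ^ m + x) + 1) * W \<le> length s * 2 ^ m * W" by (rule mult_right_mono) simp
    then show ?thesis using w by (simp add: D_def state_dim_def)
  qed
  have dec: "ket_index m W (((i - 1) * 2 ^ m + x) * W + w) = i"
    "ket_value m W (((i - 1) * 2 ^ m + x) * W + w) = x"
    "ket_work W (((i - 1) * 2 ^ m + x) * W + w) = w" if x: "x < 2 ^ m" for x
    using x w i by (auto simp: ket_index_def ket_value_def ket_work_def)
  have xb: "xor b (s ! (i - 1)) < 2 ^ m"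
    using b c by (metis take_bit_nat_eq_self_iff take_bit_xor)
  have enc: "k = ((ket_index m W k - 1) * 2 ^ m + ket_value m W k) * W + ket_work W k" for k
    by (simp only: ket_index_def ket_value_def ket_work_def add_diff_cancel_right' div_mult_mod_eq)
  show ?thesis
  proof (rule eq_vecI)
    fix r assume "r < dim_vec (unit_vec D (((i - 1) * 2 ^ m + xor b (s ! (i - 1))) * W + w))"
    then have r: "r < D" by simp
    have "(ket_index m W r = i \<and> ket_value m W r = xor b (s ! (i - 1)) \<and> ket_work W r = w) \<longleftrightarrow>
      r = ((i - 1) * 2 ^ m + xor b (s ! (i - 1))) * W + w"
      using enc[of r] dec[OF xb] by auto
    then show "(oracle_mat m W s *\<^sub>v unit_vec D (((i - 1) * 2 ^ m + b) * W + w)) $ r =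
      unit_vec D (((i - 1) * 2 ^ m + xor b (s ! (i - 1))) * W + w) $ r"
      using r bound[OF b] bound[OF xb] dec[OF b]
      by (simp add: oracle_mat_def D_def[symmetric])
  qed (simp add: oracle_mat_def D_def)
qed

definition unitary_mat :: "nat \<Rightarrow> complex mat \<Rightarrow> bool" where
  "unitary_mat d U \<longleftrightarrow>
     U \<in> carrier_mat d d \<and> mat_adjoint U * U = 1\<^sub>m d \<and> U * mat_adjoint U = 1\<^sub>m d"

text \<open>
  An algorithm applies \<open>first_unitary\<close> to \<open>|1, 0, 0\<rangle>\<close>, and then, for each element \<open>U\<close> of
  \<open>later_unitaries\<close> in turn, one oracle call followed by \<open>U\<close>. Finally it measures in the
  computational basis and applies \<open>answer\<close> to the outcome.
\<close>

record query_algorithm =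
  work_dim :: nat
  first_unitary :: "complex mat"
  later_unitaries :: "complex mat list"
  answer :: "nat \<Rightarrow> nat"

definition query_count :: "query_algorithm \<Rightarrow> nat" where
  "query_count A = length (later_unitaries A)"

definition valid_algorithm :: "nat \<Rightarrow> nat \<Rightarrow> query_algorithm \<Rightarrow> bool" where
  "valid_algorithm \<sigma> n A \<longleftrightarrow> work_dim A > 0 \<and>
     (\<forall>U \<in> insert (first_unitary A) (set (later_unitaries A)).
        unitary_mat (state_dim (char_bits \<sigma>) (work_dim A) n) U)"

definition final_state :: "nat \<Rightarrow> query_algorithm \<Rightarrow> nat list \<Rightarrow> complex vec" where
  "final_state \<sigma> A s =
     fold (\<lambda>U v. U *\<^sub>v (oracle_mat (char_bits \<sigma>) (work_dim A) s *\<^sub>v v)) (later_unitaries A)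
       (first_unitary A *\<^sub>v unit_vec (state_dim (char_bits \<sigma>) (work_dim A) (length s)) 0)"

definition output_prob :: "nat \<Rightarrow> query_algorithm \<Rightarrow> nat list \<Rightarrow> (nat \<Rightarrow> bool) \<Rightarrow> real" where
  "output_prob \<sigma> A s P =
     (\<Sum>k | k < state_dim (char_bits \<sigma>) (work_dim A) (length s) \<and> P (answer A k).
        (cmod (final_state \<sigma> A s $ k))\<^sup>2)"

text \<open>
  For \<open>\<sigma> = 1\<close> both suffix problems are solved without any query, so lower bounds
  only make sense for \<open>\<sigma> \<ge> 2\<close>.
\<close>

definition solves :: "(nat list \<Rightarrow> nat \<Rightarrow> bool) \<Rightarrow> nat \<Rightarrow> nat \<Rightarrow> query_algorithm \<Rightarrow> bool" where
  "solves Prob \<sigma> n A \<longleftrightarrow> valid_algorithm \<sigma> n A \<and>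
     (\<forall>s \<in> strings \<sigma> n. output_prob \<sigma> A s (Prob s) \<ge> 2 / 3)"

end

theory Submission
  imports Defs "HOL-Analysis.L2_Norm"
begin

text \<open>
  This is the hybrid argument of Bennett, Bernstein, Brassard and Vazirani. If \<open>t\<close> differs from \<open>s\<close>
  only at position \<open>i\<close>, then replacing \<open>O\<^sub>s\<close> by \<open>O\<^sub>t\<close> in one query moves the state by at most twice the
  norm of its component querying \<open>i\<close>. Run on a fixed string, an algorithm with \<open>T\<close> queries has
  total query norm at most \<open>T * sqrt N\<close> over any \<open>N\<close> positions (Cauchy--Schwarz), whereas it must move
  a constant distance for every single-character change that alters the answer. For the maximal
  suffix, changing position \<open>i \<ge> 2\<close> of \<open>1\<^sup>n\<close> into 2 moves the answer from 1 to \<open>i\<close>; for the minimal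
  suffix, changing position \<open>i < n\<close> of \<open>2\<^sup>n\<close> into 1 moves it from \<open>n\<close> to \<open>i\<close>.
\<close>

section \<open>Norms of restricted vectors\<close>

text \<open>Restricting the index set stands for projecting onto a span of basis kets. The square is
  then the probability of a set of outcomes, or the weight of a state on queries to one
  position.\<close>

definition norm_on :: "nat set \<Rightarrow> complex vec \<Rightarrow> real" where
  "norm_on S v = L2_set (\<lambda>k. cmod (v $ k)) S"

lemma norm_on_nonneg: "0 \<le> norm_on S v"
  by (simp add: norm_on_def)

lemma norm_on_mono:
  assumes "finite T" "S \<subseteq> T"
  shows "norm_on S v \<le> norm_on T v"
  unfolding norm_on_def L2_set_def
  by (intro real_sqrt_le_mono sum_mono2) (use assms in auto)

lemma norm_on_triangle:
  assumes "\<And>k. k \<in> S \<Longrightarrow> cmod (u $ k) \<le> cmod (v $ k) + cmod (w $ k)"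
  shows "norm_on S u \<le> norm_on S v + norm_on S w"
proof -
  have "norm_on S u \<le> L2_set (\<lambda>k. cmod (v $ k) + cmod (w $ k)) S"
    unfolding norm_on_def using assms by (intro L2_set_mono) auto
  also have "\<dots> \<le> norm_on S v + norm_on S w"
    unfolding norm_on_def by (rule L2_set_triangle_ineq)
  finally show ?thesis .
qed

lemma norm_on_reindex:
  assumes "bij_betw p S S" "\<And>k. k \<in> S \<Longrightarrow> v $ k = w $ p k"
  shows "norm_on S v = norm_on S w"
proof -
  have "(\<Sum>k\<in>S. (cmod (v $ k))\<^sup>2) = (\<Sum>k\<in>S. (cmod (w $ p k))\<^sup>2)"
    using assms(2) by (intro sum.cong) auto
  also have "\<dots> = (\<Sum>k\<in>S. (cmod (w $ k))\<^sup>2)"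
    by (rule sum.reindex_bij_betw[OF assms(1)])
  finally show ?thesis by (simp add: norm_on_def L2_set_def)
qed

lemma norm_on_sq: "(norm_on S v)\<^sup>2 = (\<Sum>k\<in>S. (cmod (v $ k))\<^sup>2)"
  by (simp add: norm_on_def L2_set_def sum_nonneg)

text \<open>Cauchy-Schwarz against the constant 1; by disjointness the squared norms add up to at
  most that over \<open>T\<close>. Applied to query blocks, it limits how much a single query can
  attend to many positions at once.\<close>

lemma sum_norm_on_le:
  assumes "finite I" "finite T" "\<And>i. i \<in> I \<Longrightarrow> S i \<subseteq> T"
    and disj: "\<And>i j. i \<in> I \<Longrightarrow> j \<in> I \<Longrightarrow> i \<noteq> j \<Longrightarrow> S i \<inter> S j = {}"
  shows "(\<Sum>i\<in>I. norm_on (S i) v) \<le> sqrt (card I) * norm_on T v"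
proof -
  have "(\<Sum>i\<in>I. norm_on (S i) v) = (\<Sum>i\<in>I. \<bar>1\<bar> * \<bar>norm_on (S i) v\<bar>)"
    by (simp add: norm_on_nonneg)
  also have "\<dots> \<le> L2_set (\<lambda>_. 1) I * L2_set (\<lambda>i. norm_on (S i) v) I"
    by (rule L2_set_mult_ineq)
  also have "L2_set (\<lambda>_. 1) I = sqrt (card I)"
    by (simp add: L2_set_def)
  also have "L2_set (\<lambda>i. norm_on (S i) v) I = norm_on (\<Union>i\<in>I. S i) v"
  proof -
    have "(\<Sum>k\<in>(\<Union>i\<in>I. S i). (cmod (v $ k))\<^sup>2) = (\<Sum>i\<in>I. \<Sum>k\<in>S i. (cmod (v $ k))\<^sup>2)"
      using assms by (intro sum.UNION_disjoint) (auto intro: finite_subset)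
    then show ?thesis
      by (simp add: L2_set_def norm_on_sq) (simp add: norm_on_def L2_set_def)
  qed
  also have "sqrt (card I) * \<dots> \<le> sqrt (card I) * norm_on T v"
    using assms by (intro mult_left_mono norm_on_mono) auto
  finally show ?thesis .
qed

section \<open>Unitary matrices preserve the norm\<close>

lemma mat_adjoint_index:
  fixes A :: "complex mat"
  assumes "i < dim_col A" "j < dim_row A"
  shows "mat_adjoint A $$ (i, j) = cnj (A $$ (j, i))"
  using assms by (simp add: mat_adjoint_def mat_of_rows_def)

lemma norm_on_unitary:
  assumes U: "unitary_mat d U" and v: "v \<in> carrier_vec d"
  shows "norm_on {..<d} (U *\<^sub>v v) = norm_on {..<d} v"
proof -
  define w where "w = U *\<^sub>v v"
  have Uc: "U \<in> carrier_mat d d" and UU: "mat_adjoint U * U = 1\<^sub>m d"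
    using U by (auto simp: unitary_mat_def)
  have adj: "mat_adjoint U \<in> carrier_mat d d"
    using Uc by (auto simp: mat_adjoint_def)
  have w: "w \<in> carrier_vec d" using Uc v by (simp add: w_def)
  have vw: "v = mat_adjoint U *\<^sub>v w"
    using assoc_mult_mat_vec[OF adj Uc v] UU v by (simp add: w_def)
  have v_idx: "v $ k = (\<Sum>r<d. cnj (U $$ (r, k)) * w $ r)" if "k < d" for k
  proof -
    have "v $ k = (mat_adjoint U *\<^sub>v w) $ k" using vw by simp
    also have "\<dots> = (\<Sum>r<d. mat_adjoint U $$ (k, r) * w $ r)"
      using that w adj by (simp add: scalar_prod_def atLeast0LessThan)
    also have "\<dots> = (\<Sum>r<d. cnj (U $$ (r, k)) * w $ r)"
      using that Uc by (intro sum.cong) (auto simp: mat_adjoint_index)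
    finally show ?thesis .
  qed
  have w_idx: "w $ r = (\<Sum>k<d. U $$ (r, k) * v $ k)" if "r < d" for r
    using that Uc v by (simp add: w_def scalar_prod_def atLeast0LessThan)
  \<comment> \<open>Since \<open>v\<close> is the adjoint of \<open>U\<close> applied to
    \<open>w\<close>, and \<open>w\<close> is \<open>U\<close> applied to \<open>v\<close>, swapping
    the two sums turns the inner product of \<open>v\<close> with itself into that of
    \<open>w\<close> with itself.\<close>
  have "complex_of_real ((norm_on {..<d} v)\<^sup>2) = (\<Sum>k<d. v $ k * cnj (v $ k))"
    by (simp add: norm_on_sq complex_norm_square del: of_real_power)
  also have "\<dots> = (\<Sum>k<d. \<Sum>r<d. cnj (U $$ (r, k)) * w $ r * cnj (v $ k))"
    by (intro sum.cong) (auto simp: v_idx sum_distrib_right)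
  also have "\<dots> = (\<Sum>r<d. \<Sum>k<d. cnj (U $$ (r, k)) * w $ r * cnj (v $ k))"
    by (rule sum.swap)
  also have "\<dots> = (\<Sum>r<d. w $ r * cnj (\<Sum>k<d. U $$ (r, k) * v $ k))"
    by (intro sum.cong) (auto simp: sum_distrib_left mult_ac)
  also have "\<dots> = (\<Sum>r<d. w $ r * cnj (w $ r))"
    by (intro sum.cong) (auto simp: w_idx)
  also have "\<dots> = complex_of_real ((norm_on {..<d} w)\<^sup>2)"
    by (simp add: norm_on_sq complex_norm_square del: of_real_power)
  finally have "(norm_on {..<d} v)\<^sup>2 = (norm_on {..<d} w)\<^sup>2"
    using of_real_eq_iff by blast
  then show ?thesis
    using norm_on_nonneg power2_eq_imp_eq by (simp add: w_def)
qed

section \<open>The oracle as a permutation of the basis\<close>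

text \<open>For characters below \<open>2 ^ m\<close>, this is the column of the single 1 in row
  \<open>r\<close> of the oracle matrix. XOR with a fixed character is its own inverse, so the same
  map also sends a column to its row.\<close>

definition oracle_flip :: "nat \<Rightarrow> nat \<Rightarrow> nat list \<Rightarrow> nat \<Rightarrow> nat" where
  "oracle_flip m W s r = ((ket_index m W r - 1) * 2 ^ m +
     xor (ket_value m W r) (s ! (ket_index m W r - 1))) * W + ket_work W r"

text \<open>Here \<open>i\<close> is a 0-based list index, hence the shift against the 1-based \<open>ket_index\<close>.\<close>

definition query_block :: "nat \<Rightarrow> nat \<Rightarrow> nat \<Rightarrow> nat \<Rightarrow> nat set" where
  "query_block m W n i = {r. r < state_dim m W n \<and> ket_index m W r = i + 1}"

lemma ket_decompose:
  "((ket_index m W r - 1) * 2 ^ m + ket_value m W r) * W + ket_work W r = r"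
  by (simp only: ket_index_def ket_value_def ket_work_def add_diff_cancel_right' div_mult_mod_eq)

lemma ket_index_le:
  assumes "r < state_dim m W n"
  shows "ket_index m W r - 1 < n"
proof -
  have "r div W < n * 2 ^ m"
    using assms by (intro less_mult_imp_div_less) (simp add: state_dim_def)
  then show ?thesis
    by (simp add: ket_index_def less_mult_imp_div_less)
qed

locale oracle_string =
  fixes m W n :: nat and s :: "nat list"
  assumes W: "W > 0" and len: "length s = n" and chars: "\<And>i. i < n \<Longrightarrow> s ! i < 2 ^ m"
begin

lemma
  assumes "r < state_dim m W n"
  shows ket_index_flip: "ket_index m W (oracle_flip m W s r) = ket_index m W r"
    and ket_value_flip: "ket_value m W (oracle_flip m W s r) =
      xor (ket_value m W r) (s ! (ket_index m W r - 1))"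
    and ket_work_flip: "ket_work W (oracle_flip m W s r) = ket_work W r"
    and oracle_flip_less: "oracle_flip m W s r < state_dim m W n"
proof -
  define a where "a = ket_index m W r - 1"
  define b where "b = xor (ket_value m W r) (s ! a)"
  have a: "a < n" using ket_index_le[OF assms] by (simp add: a_def)
  have "ket_value m W r < 2 ^ m" by (simp add: ket_value_def)
  \<comment> \<open>Characters below \<open>2 ^ m\<close> keep the XOR within \<open>m\<close> bits,
    so it does not spill over into the index component of the ket.\<close>
  then have b: "b < 2 ^ m"
    using chars[OF a] unfolding b_def by (metis take_bit_nat_eq_self_iff take_bit_xor)
  have w: "ket_work W r < W" using W by (simp add: ket_work_def)
  have idx: "ket_index m W r = a + 1" by (simp add: a_def ket_index_def)
  have fl: "oracle_flip m W s r = (a * 2 ^ m + b) * W + ket_work W r"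
    by (simp add: oracle_flip_def a_def b_def)
  show "ket_index m W (oracle_flip m W s r) = ket_index m W r"
    using b w unfolding fl idx by (simp add: ket_index_def)
  show "ket_value m W (oracle_flip m W s r) = xor (ket_value m W r) (s ! (ket_index m W r - 1))"
    using b w unfolding fl a_def[symmetric] b_def[symmetric] by (simp add: ket_value_def)
  show "ket_work W (oracle_flip m W s r) = ket_work W r"
    using w unfolding fl by (simp add: ket_work_def)
  have "a * 2 ^ m + b < (a + 1) * 2 ^ m" using b by simp
  also have "\<dots> \<le> n * 2 ^ m" using a by (intro mult_right_mono) auto
  finally have "(a * 2 ^ m + b + 1) * W \<le> n * 2 ^ m * W" by (intro mult_right_mono) auto
  then show "oracle_flip m W s r < state_dim m W n"
    using w by (simp add: fl state_dim_def)
qed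

lemma oracle_flip_flip:
  assumes "r < state_dim m W n"
  shows "oracle_flip m W s (oracle_flip m W s r) = r"
  unfolding oracle_flip_def[of m W s "oracle_flip m W s r"]
    ket_index_flip[OF assms] ket_value_flip[OF assms] ket_work_flip[OF assms]
  by (simp only: xor.assoc xor_self_eq xor.right_neutral ket_decompose)

text \<open>The left side is the condition for a 1 in the oracle matrix and amounts to
  \<open>r = oracle_flip m W s c\<close>; the involution solves this for \<open>c\<close>.
  Multiplication by the oracle thereby becomes a reindexing.\<close>

lemma oracle_flip_unique:
  assumes r: "r < state_dim m W n" and c: "c < state_dim m W n"
  shows "ket_index m W r = ket_index m W c
      \<and> ket_value m W r = xor (ket_value m W c) (s ! (ket_index m W c - 1))
      \<and> ket_work W r = ket_work W c \<longleftrightarrow> c = oracle_flip m W s r" (is "?L \<longleftrightarrow> ?R")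
proof
  assume ?L
  then have "r = oracle_flip m W s c"
    using ket_decompose[of m W r] unfolding oracle_flip_def by simp
  then show ?R using oracle_flip_flip[OF c] by simp
next
  assume ?R
  then show ?L
    using r ket_index_flip ket_value_flip ket_work_flip by (simp add: xor.assoc)
qed

lemma oracle_mat_mult_index:
  assumes r: "r < state_dim m W n" and v: "v \<in> carrier_vec (state_dim m W n)"
  shows "(oracle_mat m W s *\<^sub>v v) $ r = v $ oracle_flip m W s r"
proof -
  let ?D = "state_dim m W n"
  have "(oracle_mat m W s *\<^sub>v v) $ r = (\<Sum>c<?D. oracle_mat m W s $$ (r, c) * v $ c)"
    using r v by (simp add: oracle_mat_def len scalar_prod_def atLeast0LessThan)
  also have "\<dots> = (\<Sum>c<?D. (if c = oracle_flip m W s r then v $ c else 0))"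
    using r oracle_flip_unique[OF r] by (intro sum.cong) (auto simp: oracle_mat_def len)
  also have "\<dots> = v $ oracle_flip m W s r"
    using oracle_flip_less[OF r] by (simp add: sum.delta)
  finally show ?thesis .
qed

lemma oracle_mat_mult_carrier [simp]:
  "oracle_mat m W s *\<^sub>v v \<in> carrier_vec (state_dim m W n)"
  by (rule carrier_vecI) (simp only: dim_mult_mat_vec oracle_mat_def dim_row_mat len)

lemma norm_on_oracle:
  assumes "v \<in> carrier_vec (state_dim m W n)"
  shows "norm_on {..<state_dim m W n} (oracle_mat m W s *\<^sub>v v) = norm_on {..<state_dim m W n} v"
proof (rule norm_on_reindex)
  show "bij_betw (oracle_flip m W s) {..<state_dim m W n} {..<state_dim m W n}"
    by (rule bij_betw_byWitness[of _ "oracle_flip m W s"])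
      (auto simp: oracle_flip_flip oracle_flip_less)
qed (rule oracle_mat_mult_index[OF _ assms], simp)

text \<open>The flip keeps \<open>ket_index\<close>, so it permutes each block within
  itself.\<close>

lemma norm_on_oracle_block:
  assumes "v \<in> carrier_vec (state_dim m W n)"
  shows "norm_on (query_block m W n i) (oracle_mat m W s *\<^sub>v v) = norm_on (query_block m W n i) v"
proof (rule norm_on_reindex)
  show "bij_betw (oracle_flip m W s) (query_block m W n i) (query_block m W n i)"
    by (rule bij_betw_byWitness[of _ "oracle_flip m W s"])
      (auto simp: query_block_def oracle_flip_flip oracle_flip_less ket_index_flip)
qed (rule oracle_mat_mult_index[OF _ assms], simp add: query_block_def)

end

text \<open>Outside block \<open>i\<close> both oracles permute the basis in the same way, so the
  difference vanishes there. Inside, each oracle preserves the norm of the block, and the triangle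
  inequality costs the factor 2.\<close>

lemma oracle_diff_le:
  assumes "oracle_string m W n s" "oracle_string m W n t"
    and eq: "\<And>j. j < n \<Longrightarrow> j \<noteq> i \<Longrightarrow> s ! j = t ! j"
    and v: "v \<in> carrier_vec (state_dim m W n)"
  shows "norm_on {..<state_dim m W n} (oracle_mat m W s *\<^sub>v v - oracle_mat m W t *\<^sub>v v)
    \<le> 2 * norm_on (query_block m W n i) v"
proof -
  interpret S: oracle_string m W n s by fact
  interpret T: oracle_string m W n t by fact
  let ?D = "state_dim m W n" and ?B = "query_block m W n i"
  let ?d = "oracle_mat m W s *\<^sub>v v - oracle_mat m W t *\<^sub>v v"
  have dims [simp]: "dim_vec (oracle_mat m W s *\<^sub>v v) = ?D" "dim_vec (oracle_mat m W t *\<^sub>v v) = ?D"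
    by (simp_all add: oracle_mat_def S.len T.len)
  have zero: "?d $ r = 0" if "r \<in> {..<?D} - ?B" for r
  proof -
    \<comment> \<open>\<open>ket_index\<close> is at least 1, so subtracting 1 is never truncated
      and \<open>ket_index m W r\<close> being different from \<open>i + 1\<close> carries over to
      the 0-based index.\<close>
    have r: "r < ?D" "ket_index m W r - 1 \<noteq> i"
      using that by (auto simp: query_block_def ket_index_def)
    then have "oracle_flip m W s r = oracle_flip m W t r"
      using eq[OF ket_index_le[OF r(1)]] by (simp add: oracle_flip_def)
    then show ?thesis
      using r v dims
      by (simp add: S.oracle_mat_mult_index T.oracle_mat_mult_index
          del: index_mult_mat_vec dim_mult_mat_vec)
  qed
  have sub: "?B \<subseteq> {..<?D}" by (auto simp: query_block_def)
  have "(\<Sum>k<?D. (cmod (?d $ k))\<^sup>2) = (\<Sum>k\<in>?B. (cmod (?d $ k))\<^sup>2)"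
    by (rule sum.mono_neutral_right) (use zero sub in auto)
  then have "norm_on {..<?D} ?d = norm_on ?B ?d"
    by (simp only: norm_on_def L2_set_def)
  also have "\<dots> \<le> norm_on ?B (oracle_mat m W s *\<^sub>v v) + norm_on ?B (oracle_mat m W t *\<^sub>v v)"
    by (rule norm_on_triangle) (use sub dims in \<open>auto intro!: norm_triangle_ineq4 simp del: index_mult_mat_vec dim_mult_mat_vec\<close>)
  also have "\<dots> = 2 * norm_on ?B v"
    using v by (simp add: S.norm_on_oracle_block T.norm_on_oracle_block)
  finally show ?thesis .
qed

section \<open>The hybrid argument\<close>

text \<open>Unlike in \<open>final_state\<close>, the list of unitaries and the start vector are
  parameters: \<open>take q Us\<close> then gives the state before query \<open>q\<close> (counted
  from 0), and inductions can append one query at the end.\<close>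

definition run :: "nat \<Rightarrow> nat \<Rightarrow> nat list \<Rightarrow> complex mat list \<Rightarrow> complex vec \<Rightarrow> complex vec" where
  "run m W s Us v = fold (\<lambda>U v. U *\<^sub>v (oracle_mat m W s *\<^sub>v v)) Us v"

lemma run_carrier:
  assumes "\<forall>U\<in>set Us. unitary_mat D U" "v \<in> carrier_vec D"
  shows "run m W s Us v \<in> carrier_vec D"
  using assms(1)
proof (induction Us rule: rev_induct)
  case (snoc U Us)
  have "dim_row U = D" using snoc.prems by (auto simp: unitary_mat_def)
  then show ?case
    unfolding run_def by (intro carrier_vecI) (simp only: fold_append fold.simps o_apply id_apply dim_mult_mat_vec)
qed (simp add: run_def assms(2))

lemma norm_on_run:
  assumes "oracle_string m W n s" and "\<forall>U\<in>set Us. unitary_mat (state_dim m W n) U"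
    and v: "v \<in> carrier_vec (state_dim m W n)"
  shows "norm_on {..<state_dim m W n} (run m W s Us v) = norm_on {..<state_dim m W n} v"
  using assms(2)
proof (induction Us rule: rev_induct)
  case (snoc U Us)
  interpret S: oracle_string m W n s by fact
  have "run m W s Us v \<in> carrier_vec (state_dim m W n)"
    using snoc.prems v by (intro run_carrier) auto
  then show ?case
    using snoc norm_on_unitary[of "state_dim m W n" U] S.norm_on_oracle by (simp add: run_def)
qed (simp add: run_def)

text \<open>Each query adds the error of exchanging the oracles on the current state, while errors
  already made are carried along isometrically. The right side involves only the run on
  \<open>s\<close>, so it can be summed over many choices of \<open>i\<close> and
  \<open>t\<close>.\<close>

lemma run_diff_le:
  assumes s: "oracle_string m W n s" and t: "oracle_string m W n t"
    and eq: "\<And>j. j < n \<Longrightarrow> j \<noteq> i \<Longrightarrow> s ! j = t ! j"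
    and "\<forall>U\<in>set Us. unitary_mat (state_dim m W n) U"
    and v: "v \<in> carrier_vec (state_dim m W n)"
  shows "norm_on {..<state_dim m W n} (run m W s Us v - run m W t Us v)
    \<le> 2 * (\<Sum>q<length Us. norm_on (query_block m W n i) (run m W s (take q Us) v))"
  using assms(4)
proof (induction Us rule: rev_induct)
  case Nil
  then show ?case using v by (simp add: run_def norm_on_def L2_set_def)
next
  case (snoc U Us)
  interpret S: oracle_string m W n s by fact
  interpret T: oracle_string m W n t by fact
  let ?D = "state_dim m W n"
  let ?N = "norm_on {..<?D}"
  define a where "a = run m W s Us v"
  define b where "b = run m W t Us v"
  have U: "unitary_mat ?D U" and Us: "\<forall>U\<in>set Us. unitary_mat ?D U"
    using snoc.prems by auto
  then have Uc: "U \<in> carrier_mat ?D ?D" by (simp add: unitary_mat_def)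
  have a: "a \<in> carrier_vec ?D" and b: "b \<in> carrier_vec ?D"
    using run_carrier Us v by (auto simp: a_def b_def)
  have Ot: "oracle_mat m W t \<in> carrier_mat ?D ?D"
    by (simp add: oracle_mat_def T.len)
  have "?N (run m W s (Us @ [U]) v - run m W t (Us @ [U]) v)
      = ?N (U *\<^sub>v (oracle_mat m W s *\<^sub>v a) - U *\<^sub>v (oracle_mat m W t *\<^sub>v b))"
    by (simp add: run_def a_def b_def)
  also have "\<dots> = ?N (U *\<^sub>v (oracle_mat m W s *\<^sub>v a - oracle_mat m W t *\<^sub>v b))"
    by (subst mult_minus_distrib_mat_vec[OF Uc]) auto
  also have "\<dots> = ?N (oracle_mat m W s *\<^sub>v a - oracle_mat m W t *\<^sub>v b)"
    by (rule norm_on_unitary[OF U]) auto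
  \<comment> \<open>The hybrid step inserts the oracle for \<open>t\<close> applied to
    \<open>a\<close>: the first term is the new error, the second the old error passed through one
    more query.\<close>
  also have "\<dots> \<le> ?N (oracle_mat m W s *\<^sub>v a - oracle_mat m W t *\<^sub>v a)
      + ?N (oracle_mat m W t *\<^sub>v (a - b))"
  proof (rule norm_on_triangle)
    fix k assume "k \<in> {..<?D}"
    moreover have "dim_vec (oracle_mat m W s *\<^sub>v a) = ?D" "dim_vec (oracle_mat m W t *\<^sub>v a) = ?D"
      "dim_vec (oracle_mat m W t *\<^sub>v b) = ?D"
      by (simp_all add: oracle_mat_def S.len T.len)
    moreover have "oracle_mat m W t *\<^sub>v (a - b) = oracle_mat m W t *\<^sub>v a - oracle_mat m W t *\<^sub>v b"
      by (rule mult_minus_distrib_mat_vec[OF Ot a b])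
    ultimately show "cmod ((oracle_mat m W s *\<^sub>v a - oracle_mat m W t *\<^sub>v b) $ k)
      \<le> cmod ((oracle_mat m W s *\<^sub>v a - oracle_mat m W t *\<^sub>v a) $ k)
        + cmod ((oracle_mat m W t *\<^sub>v (a - b)) $ k)"
      using norm_triangle_ineq[of "(oracle_mat m W s *\<^sub>v a) $ k - (oracle_mat m W t *\<^sub>v a) $ k"
          "(oracle_mat m W t *\<^sub>v a) $ k - (oracle_mat m W t *\<^sub>v b) $ k"]
      by (simp del: index_mult_mat_vec)
  qed
  also have "\<dots> \<le> 2 * norm_on (query_block m W n i) a + ?N (a - b)"
    using oracle_diff_le[OF s t eq a] T.norm_on_oracle[of "a - b"] a b by simp
  also have "\<dots> \<le> 2 * norm_on (query_block m W n i) a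
      + 2 * (\<Sum>q<length Us. norm_on (query_block m W n i) (run m W s (take q Us) v))"
    using snoc.IH Us by (simp add: a_def b_def)
  finally show ?case by (simp add: a_def)
qed

section \<open>Query bound from inputs without a common answer\<close>

lemma sqrt_two_thirds_gap: "sqrt (1 / 3) + 1 / 5 \<le> sqrt (2 / 3 :: real)"
proof -
  \<comment> \<open>Rational bounds suffice: 9/25 is at least 1/3, and 16/25 is at most 2/3.\<close>
  have "sqrt (1 / 3) \<le> (3 / 5 :: real)"
    by (rule real_le_lsqrt) (auto simp: power2_eq_square)
  moreover have "(4 / 5 :: real) \<le> sqrt (2 / 3)"
    by (rule real_le_rsqrt) (auto simp: power2_eq_square)
  ultimately show ?thesis by simp
qed

text \<open>Each changed input forces a final distance of at least 1/5, while one query contributes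
  at most \<open>2 * sqrt (card I)\<close> to the sum of these distances over \<open>I\<close>.
  Hence the factor 10. The positions in \<open>I\<close> are 0-based.\<close>

lemma query_count_ge_sqrt_card:
  assumes sol: "solves Prob \<sigma> n A" and x: "x \<in> strings \<sigma> n"
    and I: "I \<subseteq> {..<n}" and c: "c \<in> {1..\<sigma>}"
    and excl: "\<And>i j. i \<in> I \<Longrightarrow> Prob x j \<Longrightarrow> \<not> Prob (x[i := c]) j"
  shows "sqrt (card I) \<le> 10 * real (query_count A)"
proof (cases "I = {}")
  \<comment> \<open>A nonempty \<open>I\<close> makes \<open>n\<close> positive, so index 0 exists
    and the initial ket has norm 1; it also permits the final cancellation of
    \<open>sqrt (card I)\<close>.\<close>
  case False
  define m where "m = char_bits \<sigma>"
  define W where "W = work_dim A"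
  define D where "D = state_dim m W n"
  define Us where "Us = later_unitaries A"
  define v where "v = first_unitary A *\<^sub>v unit_vec D 0"
  have fin: "finite I" using I by (rule finite_subset) simp
  have W: "W > 0" and U0: "unitary_mat D (first_unitary A)" and Us: "\<forall>U\<in>set Us. unitary_mat D U"
    using sol by (auto simp: solves_def valid_algorithm_def m_def W_def D_def Us_def)
  have "n > 0" using False I by auto
  then have D0: "D > 0" using W by (simp add: D_def state_dim_def)
  have v: "v \<in> carrier_vec D"
    unfolding v_def using U0 by (intro mult_mat_vec_carrier[of _ D D]) (simp_all add: unitary_mat_def)
  have "(norm_on {..<D} (unit_vec D 0))\<^sup>2 = (\<Sum>k<D. if k = 0 then 1 else 0)"
    unfolding norm_on_sq by (rule sum.cong) auto
  also have "\<dots> = 1" using D0 by simp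
  finally have "norm_on {..<D} (unit_vec D 0) = 1"
    using norm_on_nonneg[of "{..<D}" "unit_vec D 0"] unfolding power2_eq_1_iff by linarith
  then have v1: "norm_on {..<D} v = 1"
    using norm_on_unitary[OF U0, of "unit_vec D 0"] by (simp add: v_def)
  have \<sigma>: "\<sigma> < 2 ^ m"
    using floorlog_bounds[of \<sigma> 2] c by (simp add: m_def char_bits_def)
  have ora: "oracle_string m W n s" if "s \<in> strings \<sigma> n" for s
  proof
    show "W > 0" "length s = n" using that W by (auto simp: strings_def)
    show "s ! i < 2 ^ m" if "i < n" for i
    proof -
      have "s ! i \<in> {1..\<sigma>}"
        using \<open>s \<in> strings \<sigma> n\<close> that nth_mem[of i s] unfolding strings_def by blast
      then show ?thesis using \<sigma> by simp
    qed
  qed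
  define E where "E s = {k. k < D \<and> Prob s (answer A k)}" for s
  have prob: "2 / 3 \<le> (norm_on (E s) (run m W s Us v))\<^sup>2" if "s \<in> strings \<sigma> n" for s
  proof -
    have "final_state \<sigma> A s = run m W s Us v" "length s = n"
      using that
      by (simp_all add: final_state_def run_def m_def W_def Us_def v_def D_def strings_def)
    then have "output_prob \<sigma> A s (Prob s) = (norm_on (E s) (run m W s Us v))\<^sup>2"
      unfolding output_prob_def norm_on_sq E_def D_def m_def W_def by simp
    moreover have "2 / 3 \<le> output_prob \<sigma> A s (Prob s)"
      using sol that unfolding solves_def by blast
    ultimately show ?thesis by simp
  qed
  have x_update: "x[i := c] \<in> strings \<sigma> n" for i
    using x c set_update_subset_insert[of x i c] by (auto simp: strings_def)
  have dist: "1 / 5 \<le> norm_on {..<D} (run m W x Us v - run m W (x[i := c]) Us v)"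
    if i: "i \<in> I" for i
  proof -
    define y where "y = x[i := c]"
    have y: "y \<in> strings \<sigma> n" unfolding y_def by (rule x_update)
    define f where "f = run m W x Us v"
    define g where "g = run m W y Us v"
    have dims: "dim_vec f = D" "dim_vec g = D"
      unfolding f_def g_def by (intro carrier_vecD run_carrier[OF Us v])+
    have disj: "E x \<inter> E y = {}" using excl[OF i] by (auto simp: E_def y_def)
    \<comment> \<open>On input \<open>y\<close> the outcomes correct for \<open>y\<close> have
      probability at least 2/3, which leaves at most 1/3 for those correct for \<open>x\<close>. On
      input \<open>x\<close> the latter have at least 2/3, so the two states must be apart on
      \<open>E x\<close>.\<close>
    have "(norm_on (E x) g)\<^sup>2 + (norm_on (E y) g)\<^sup>2 = (norm_on (E x \<union> E y) g)\<^sup>2"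
      unfolding norm_on_sq by (rule sum.union_disjoint[symmetric]) (use disj in \<open>auto simp: E_def\<close>)
    also have "\<dots> \<le> (norm_on {..<D} g)\<^sup>2"
      by (intro power_mono norm_on_mono norm_on_nonneg) (auto simp: E_def)
    also have "\<dots> = 1"
      using norm_on_run[OF ora[OF y], of Us v] Us v v1 by (simp add: D_def g_def)
    finally have "(norm_on (E x) g)\<^sup>2 \<le> 1 / 3"
      using prob[OF y] by (simp add: g_def)
    then have "norm_on (E x) g \<le> sqrt (1 / 3)"
      by (rule real_le_rsqrt)
    moreover have "sqrt (2 / 3) \<le> norm_on (E x) f"
      unfolding f_def by (intro real_le_lsqrt norm_on_nonneg prob[OF x])
    moreover have "norm_on (E x) f \<le> norm_on (E x) (f - g) + norm_on (E x) g"
    proof (rule norm_on_triangle)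
      fix k assume "k \<in> E x"
      then show "cmod (f $ k) \<le> cmod ((f - g) $ k) + cmod (g $ k)"
        using dims norm_triangle_ineq[of "f $ k - g $ k" "g $ k"] by (simp add: E_def)
    qed
    moreover have "norm_on (E x) (f - g) \<le> norm_on {..<D} (f - g)"
      by (intro norm_on_mono) (auto simp: E_def)
    ultimately show ?thesis
      using sqrt_two_thirds_gap by (simp add: f_def g_def y_def)
  qed
  let ?B = "query_block m W n"
  have blocks: "?B i \<subseteq> {..<D}" "i \<noteq> j \<Longrightarrow> ?B i \<inter> ?B j = {}" for i j
    by (auto simp: query_block_def D_def)
  have "card I / 5 = (\<Sum>i\<in>I. 1 / 5)" by simp
  also have "\<dots> \<le> (\<Sum>i\<in>I. norm_on {..<D} (run m W x Us v - run m W (x[i := c]) Us v))"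
    by (intro sum_mono dist)
  also have "\<dots> \<le> (\<Sum>i\<in>I. 2 * (\<Sum>q<length Us. norm_on (?B i) (run m W x (take q Us) v)))"
  proof (rule sum_mono)
    fix i assume "i \<in> I"
    show "norm_on {..<D} (run m W x Us v - run m W (x[i := c]) Us v)
      \<le> 2 * (\<Sum>q<length Us. norm_on (?B i) (run m W x (take q Us) v))"
      unfolding D_def
      by (rule run_diff_le[OF ora[OF x] ora[OF x_update]]) (use Us v in \<open>auto simp: D_def\<close>)
  qed
  \<comment> \<open>With the query number outside, the inner sum concerns one unit vector and
    disjoint blocks, as \<open>sum_norm_on_le\<close> requires.\<close>
  also have "\<dots> = 2 * (\<Sum>q<length Us. \<Sum>i\<in>I. norm_on (?B i) (run m W x (take q Us) v))"
    by (subst sum.swap) (simp add: sum_distrib_left)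
  also have "\<dots> \<le> 2 * (\<Sum>q<length Us. sqrt (card I))"
  proof (intro mult_left_mono sum_mono)
    fix q
    have "\<forall>U\<in>set (take q Us). unitary_mat D U" using Us by (auto dest: in_set_takeD)
    then have "norm_on {..<D} (run m W x (take q Us) v) = 1"
      using norm_on_run[OF ora[OF x], of "take q Us" v] v v1 by (simp add: D_def)
    moreover have "(\<Sum>i\<in>I. norm_on (?B i) (run m W x (take q Us) v))
        \<le> sqrt (card I) * norm_on {..<D} (run m W x (take q Us) v)"
      by (intro sum_norm_on_le fin finite_lessThan blocks)
    ultimately show "(\<Sum>i\<in>I. norm_on (?B i) (run m W x (take q Us) v)) \<le> sqrt (card I)"
      by simp
  qed simp
  \<comment> \<open>\<open>card I\<close> is split into two square roots so that one of them
    cancels.\<close>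
  finally have "sqrt (card I) * sqrt (card I) \<le> 10 * real (query_count A) * sqrt (card I)"
    by (simp add: Us_def query_count_def)
  then show ?thesis
    by (rule mult_right_le_imp_le) (use False fin in \<open>simp add: card_gt_0_iff\<close>)
qed simp

section \<open>Suffixes of nearly constant strings\<close>

lemma lex_less_Nil: "lex_less [] s \<longleftrightarrow> s \<noteq> []" "\<not> lex_less s []"
  by (cases s; simp add: lex_less_def)+

lemma lex_less_Cons: "lex_less (a # s) (b # t) \<longleftrightarrow> a < b \<or> a = b \<and> lex_less s t"
  by (simp add: lex_less_def)

lemma lex_less_replicate: "lex_less (replicate a c) (replicate b c) \<longleftrightarrow> a < b"
proof (induction a arbitrary: b)
  case 0
  then show ?case by (simp add: lex_less_Nil)
next
  case (Suc a)
  then show ?case by (cases b) (simp_all add: lex_less_Nil lex_less_Cons)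
qed

lemma suffix_from_replicate: "suffix_from (replicate n c) j = replicate (n - (j - 1)) c"
  by (simp add: suffix_from_def)

lemma suffix_from_Cons:
  assumes "j \<in> {1..length s}"
  shows "suffix_from s j = s ! (j - 1) # drop j s"
  using assms by (cases j) (simp_all add: suffix_from_def Cons_nth_drop_Suc)

text \<open>Suffixes of a constant string compare by length, so \<open>j\<close> is 1. Index 0 is
  excluded because a 2 in front of a string of 1s leaves the answer at 1.\<close>

lemma maximal_suffix_distinct:
  assumes i: "i \<in> {1..<n}" and s: "is_maximal_suffix (replicate n 1) j"
  shows "\<not> is_maximal_suffix ((replicate n 1)[i := 2]) j"
proof
  assume t: "is_maximal_suffix ((replicate n 1)[i := 2]) j"
  have j: "j \<in> {1..n}" using s by (simp add: is_maximal_suffix_def)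
  have "j = 1"
  proof (rule ccontr)
    assume "j \<noteq> 1"
    then have "lex_less (suffix_from (replicate n 1) 1) (suffix_from (replicate n 1) j)"
      using s i by (auto simp: is_maximal_suffix_def)
    then show False by (auto simp: suffix_from_replicate lex_less_replicate)
  qed
  \<comment> \<open>List index \<open>i\<close> is position \<open>i + 1\<close>. That suffix starts
    with 2 and the one at \<open>j\<close> with 1, so the first characters refute this.\<close>
  then have "lex_less (suffix_from ((replicate n 1)[i := 2]) (i + 1))
      (suffix_from ((replicate n 1)[i := 2]) j)"
    using t i by (auto simp: is_maximal_suffix_def)
  then show False
    using i j \<open>j = 1\<close> by (auto simp: suffix_from_Cons lex_less_Cons)
qed

text \<open>Here the shortest suffix wins, so \<open>j\<close> is \<open>n\<close>. The last index
  is excluded because a final 1 after 2s leaves the answer at \<open>n\<close>.\<close>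

lemma minimal_suffix_distinct:
  assumes i: "i < n - 1" and s: "is_minimal_suffix (replicate n 2) j"
  shows "\<not> is_minimal_suffix ((replicate n 2)[i := 1]) j"
proof
  assume t: "is_minimal_suffix ((replicate n 2)[i := 1]) j"
  have j: "j \<in> {1..n}" using s by (simp add: is_minimal_suffix_def)
  have "j = n"
  proof (rule ccontr)
    assume "j \<noteq> n"
    then have "lex_less (suffix_from (replicate n 2) j) (suffix_from (replicate n 2) n)"
      using s i by (auto simp: is_minimal_suffix_def)
    then have "n - (j - 1) < n - (n - 1)"
      unfolding suffix_from_replicate lex_less_replicate .
    then show False using i j by auto
  qed
  then have "lex_less (suffix_from ((replicate n 2)[i := 1]) j)
      (suffix_from ((replicate n 2)[i := 1]) (i + 1))"
    using t i by (auto simp: is_minimal_suffix_def)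
  then show False
    using i j \<open>j = n\<close> by (auto simp: suffix_from_Cons lex_less_Cons)
qed

section \<open>The constant and the two bounds\<close>

lemma sqrt_lower_bound:
  assumes "2 \<le> n" "sqrt (n - 1 :: nat) \<le> 10 * q"
  shows "1 / 20 * sqrt n \<le> q"
proof -
  \<comment> \<open>The factor 4 leaves slack but has the exact root 2, which turns 10 into
    20.\<close>
  have "sqrt n \<le> sqrt (4 * (n - 1 :: nat))"
    using assms(1) by (intro real_sqrt_le_mono) (simp add: of_nat_diff)
  then show ?thesis using assms(2) by (simp add: real_sqrt_mult)
qed

theorem mainTheorem6:
  fixes k :: nat
  shows "(\<exists>c>0. \<forall>\<^sub>F n in sequentially. \<forall>\<sigma> A.
            2 \<le> \<sigma> \<longrightarrow> \<sigma> \<le> n ^ k \<longrightarrow> solves is_maximal_suffix \<sigma> n A \<longrightarrow>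
              c * sqrt (real n) \<le> real (query_count A))
       \<and> (\<exists>c>0. \<forall>\<^sub>F n in sequentially. \<forall>\<sigma> A.
            2 \<le> \<sigma> \<longrightarrow> \<sigma> \<le> n ^ k \<longrightarrow> solves is_minimal_suffix \<sigma> n A \<longrightarrow>
              c * sqrt (real n) \<le> real (query_count A))"
proof -
  have max: "1 / 20 * sqrt n \<le> query_count A"
    if "2 \<le> n" "2 \<le> \<sigma>" "solves is_maximal_suffix \<sigma> n A" for n \<sigma> A
  proof (rule sqrt_lower_bound)
    have "sqrt (card {1..<n}) \<le> 10 * real (query_count A)"
      by (rule query_count_ge_sqrt_card[OF that(3), of "replicate n 1" _ 2])
        (use that maximal_suffix_distinct in \<open>auto simp: strings_def\<close>)
    then show "sqrt (n - 1 :: nat) \<le> 10 * real (query_count A)" by simp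
  qed fact
  have min: "1 / 20 * sqrt n \<le> query_count A"
    if "2 \<le> n" "2 \<le> \<sigma>" "solves is_minimal_suffix \<sigma> n A" for n \<sigma> A
  proof (rule sqrt_lower_bound)
    have "sqrt (card {..<n - 1}) \<le> 10 * real (query_count A)"
      by (rule query_count_ge_sqrt_card[OF that(3), of "replicate n 2" _ 1])
        (use that minimal_suffix_distinct in \<open>auto simp: strings_def\<close>)
    then show "sqrt (n - 1 :: nat) \<le> 10 * real (query_count A)" by simp
  qed fact
  \<comment> \<open>Both bounds hold from \<open>n\<close> = 2 on, with the same constant for all
    \<sigma> and \<open>A\<close>.\<close>
  show ?thesis
    by (intro conjI exI[of _ "1 / 20 :: real"] eventually_sequentiallyI[of 2])
      (use max min in auto)
qed

end
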